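(* Let $\beta_1,\beta_2>0$ with $\beta_1-\beta_2\notin\mathbb Z$, $0<c<1$, and let $(n_1,n_2)\in\mathbb N_0^2$. Let $M^{(1)}_{(n_1,n_2)},M^{(2)}_{(n_1,n_2)}$ be the Meixner II multiple orthogonal polynomials of type I (for the weights $\omega_a(k)=\frac{\Gamma(\beta_a+k)c^k}{\Gamma(\beta_a)\Gamma(k+1)}$, $k\in\mathbb N_0$, $a\in\{1,2\}$) biorthogonal to the monic Meixner II polynomials of type II. Then, for $a\in\{1,2\}$, $$M^{(a)}_{(n_1,n_2)}(x)=K_a\;F^{1:2;1}_{1:1;0}\left[{(-n_a+1):(-x,\ \beta_a-\hat\beta_a-\hat n_a+1);(\hat\beta_a-\beta_a-n_a+1)\atop(-n_1-n_2+2):(\beta_a);--}\Bigg|1,\frac{c}{c-1}\right]$$ $$=K_a\sum_{l=0}^{n_a-1}\frac{1}{l!}\frac{(\beta_a-\hat\beta_a-\hat n_a+1)_l}{(\beta_a)_l}\sum_{m=0}^{n_a-1-l}\frac{(-n_a+1)_{l+m}}{m!}\frac{(\hat\beta_a-\beta_a-n_a+1)_m}{(-n_1-n_2+2)_{l+m}}\left(\frac{c}{c-1}\right)^m(-x)_l,$$ where $$K_a=\frac{(1-c)^{\beta_a+n_1+n_2+n_a-2}}{c^{n_1+n_2-1}}\,\frac{(-1)^{n_a-1}(n_1+n_2-2)!}{(n_1-1)!\,(n_2-1)!}\,\frac{1}{(\beta_a-\hat\beta_a-\hat n_a+1)_{n_1+n_2-1}}.$$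
   Context: Pochhammer symbol: $(x)_n=\Gamma(x+n)/\Gamma(x)$, i.e. $(x)_0=1$, $(x)_n=x(x+1)\cdots(x+n-1)$. Notation: $\hat\beta_1=\beta_2$, $\hat\beta_2=\beta_1$, $\hat n_1=n_2$, $\hat n_2=n_1$. The type II polynomial $M_{(m_1,m_2)}$, $(m_1,m_2)\in\mathbb N_0^2$, is the monic polynomial of degree $m_1+m_2$ with $\sum_{k=0}^\infty(-k)_jM_{(m_1,m_2)}(k)\,\omega_a(k)=0$ for $j\in\{0,\dots,m_a-1\}$, $a\in\{1,2\}$. The type I polynomials biorthogonal to them have $\deg M^{(a)}_{(n_1,n_2)}\le n_a-1$ and satisfy $$\sum_{k=0}^\infty(-k)_j\big(M^{(1)}_{(n_1,n_2)}(k)\omega_1(k)+M^{(2)}_{(n_1,n_2)}(k)\omega_2(k)\big)=0,\quad j\in\{0,\dots,n_1+n_2-2\},$$ and $$\sum_{k=0}^\infty M_{(m_1,m_2)}(k)\big(M^{(1)}_{(n_1,n_2)}(k)\omega_1(k)+M^{(2)}_{(n_1,n_2)}(k)\omega_2(k)\big)=\begin{cases}0,&n_1\le m_1,\ n_2\le m_2,\\1,&m_1+m_2=n_1+n_2-1,\\0,&m_1+m_2\le n_1+n_2-2.\end{cases}$$ Kampé de Fériet series: $$F^{p:r;s}_{q:n;t}\left[{(a_i):(b_i);(d_i)\atop(\alpha_i):(\beta_i);(\gamma_i)}\Bigg|x,y\right]=\sum_{l,m\ge0}\frac{\prod_i(a_i)_{l+m}}{\prod_i(\alpha_i)_{l+m}}\frac{\prod_i(b_i)_l}{\prod_i(\beta_i)_l}\frac{\prod_i(d_i)_m}{\prod_i(\gamma_i)_m}\frac{x^l}{l!}\frac{y^m}{m!},$$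 "$--$" denoting an empty list.
   Formalization: If n_1 or n_2 is 0 the displayed formula is undefined ((-1)!, and 0·∞ for n_a≥2). There it is read as the limit as \hat n_a→0 through real values (factorials and Pochhammer symbols via Gamma) when \hat n_a=0<n_a, and as M^{(a)}=0 when n_a=0; for n_1,n_2≥1 it is literal. *)

theory Defs
  imports "HOL-Analysis.Analysis" "HOL-Computational_Algebra.Polynomial"
begin

text \<open>
  Pairs such as \<open>(\<beta>\<^sub>1, \<beta>\<^sub>2)\<close> and \<open>(n\<^sub>1, n\<^sub>2)\<close> are functions on \<open>nat\<close> of which only the values
  at \<open>1\<close> and \<open>2\<close> are used; \<open>hat f a\<close> is the entry with the other index.
\<close>

definition hat :: "(nat \<Rightarrow> 'a) \<Rightarrow> nat \<Rightarrow> 'a" where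
  "hat f a = f (3 - a)"

definition meixner_weight :: "real \<Rightarrow> real \<Rightarrow> nat \<Rightarrow> real" where
  "meixner_weight b c k = Gamma (b + real k) * c ^ k / (Gamma b * Gamma (real k + 1))"

definition meixner_type_II :: "(nat \<Rightarrow> real) \<Rightarrow> real \<Rightarrow> (nat \<Rightarrow> nat) \<Rightarrow> real poly \<Rightarrow> bool" where
  "meixner_type_II \<beta> c m P \<longleftrightarrow>
     degree P = m 1 + m 2 \<and> lead_coeff P = 1 \<and>
     (\<forall>a\<in>{1, 2}. \<forall>j < m a.
        (\<lambda>k. pochhammer (- real k) j * poly P (real k) * meixner_weight (\<beta> a) c k) sums 0)"

definition type_I_form :: "(nat \<Rightarrow> real) \<Rightarrow> real \<Rightarrow> (nat \<Rightarrow> real poly) \<Rightarrow> nat \<Rightarrow> real" where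
  "type_I_form \<beta> c M k =
     poly (M 1) (real k) * meixner_weight (\<beta> 1) c k + poly (M 2) (real k) * meixner_weight (\<beta> 2) c k"

text \<open>
  The bound \<open>deg M a \<le> n a - 1\<close> means \<open>M a = 0\<close> when \<open>n a = 0\<close>. Index ranges
  are written without subtraction, so that \<open>j \<le> n\<^sub>1 + n\<^sub>2 - 2\<close> is empty for \<open>n\<^sub>1 + n\<^sub>2 < 2\<close>.
\<close>

definition meixner_type_I :: "(nat \<Rightarrow> real) \<Rightarrow> real \<Rightarrow> (nat \<Rightarrow> nat) \<Rightarrow> (nat \<Rightarrow> real poly) \<Rightarrow> bool" where
  "meixner_type_I \<beta> c n M \<longleftrightarrow>
     (\<forall>a\<in>{1, 2}. M a = 0 \<or> degree (M a) < n a) \<and>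
     (\<forall>j. j + 2 \<le> n 1 + n 2 \<longrightarrow>
        (\<lambda>k. pochhammer (- real k) j * type_I_form \<beta> c M k) sums 0) \<and>
     (\<forall>m P. meixner_type_II \<beta> c m P \<longrightarrow>
        (n 1 \<le> m 1 \<and> n 2 \<le> m 2 \<longrightarrow> (\<lambda>k. poly P (real k) * type_I_form \<beta> c M k) sums 0) \<and>
        (m 1 + m 2 + 1 = n 1 + n 2 \<longrightarrow> (\<lambda>k. poly P (real k) * type_I_form \<beta> c M k) sums 1) \<and>
        (m 1 + m 2 + 2 \<le> n 1 + n 2 \<longrightarrow> (\<lambda>k. poly P (real k) * type_I_form \<beta> c M k) sums 0))"

definition pochs :: "real list \<Rightarrow> nat \<Rightarrow> real" where
  "pochs as k = prod_list (map (\<lambda>a. pochhammer a k) as)"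

text \<open>
  A term whose numerator and denominator both vanish counts as \<open>0\<close> (division by zero), the usual
  convention for a series that terminates because of a numerator parameter \<open>-N\<close> and
  has a denominator parameter \<open>-N'\<close> with \<open>N' \<ge> N\<close>.
\<close>

definition kampe_de_feriet ::
  "real list \<Rightarrow> real list \<Rightarrow> real list \<Rightarrow> real list \<Rightarrow> real list \<Rightarrow> real list \<Rightarrow> real \<Rightarrow> real \<Rightarrow> real" where
  "kampe_de_feriet as bs ds \<alpha>s \<beta>s \<gamma>s x y =
     (\<Sum>\<^sub>\<infinity>(l, m)\<in>UNIV. pochs as (l + m) / pochs \<alpha>s (l + m) * (pochs bs l / pochs \<beta>s l) *
        (pochs ds m / pochs \<gamma>s m) * (x ^ l / fact l) * (y ^ m / fact m))"

text \<open>
  Below, \<open>b\<close>, \<open>b'\<close>, \<open>p\<close>, \<open>q\<close> stand for \<open>\<beta>\<^sub>a\<close>, \<open>hat \<beta> a\<close>, \<open>n\<^sub>a\<close>, \<open>hat n a\<close>. The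
  argument \<open>q\<close> of the two sums is real, because for \<open>hat n a = 0 < n\<^sub>a\<close> the formula has the
  indeterminate form \<open>0 \<cdot> \<infinity>\<close>
  (\<open>1 / (hat n a - 1)! = 0\<close>, while \<open>(- n\<^sub>1 - n\<^sub>2 + 2)\<^sub>k = 0\<close> for \<open>k = n\<^sub>a - 1 > 0\<close>,
  and \<open>(n\<^sub>1 + n\<^sub>2 - 2)! = \<infinity>\<close> for \<open>n\<^sub>a = 1\<close>) and is read as the limit \<open>q \<rightarrow> 0\<close>.
\<close>

definition type_I_series :: "real \<Rightarrow> real \<Rightarrow> real \<Rightarrow> nat \<Rightarrow> real \<Rightarrow> real \<Rightarrow> real" where
  "type_I_series b b' c p q x =
     kampe_de_feriet [- real p + 1] [- x, b - b' - q + 1] [b' - b - real p + 1]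
       [- real p - q + 2] [b] [] 1 (c / (c - 1))"

definition type_I_sum :: "real \<Rightarrow> real \<Rightarrow> real \<Rightarrow> nat \<Rightarrow> real \<Rightarrow> real \<Rightarrow> real" where
  "type_I_sum b b' c p q x =
     (\<Sum>l<p. 1 / fact l * (pochhammer (b - b' - q + 1) l / pochhammer b l) *
        (\<Sum>m<p - l. pochhammer (- real p + 1) (l + m) / fact m *
           (pochhammer (b' - b - real p + 1) m / pochhammer (- real p - q + 2) (l + m)) *
           (c / (c - 1)) ^ m * pochhammer (- x) l))"

definition type_I_const :: "real \<Rightarrow> real \<Rightarrow> real \<Rightarrow> nat \<Rightarrow> nat \<Rightarrow> real" where
  "type_I_const b b' c p q =
     (1 - c) powr (b + real p + real q + real p - 2) / c ^ (p + q - 1) *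
     ((-1) ^ (p - 1) * fact (p + q - 2) / (fact (p - 1) * fact (q - 1))) *
     (1 / pochhammer (b - b' - real q + 1) (p + q - 1))"

text \<open>
  The same constant for real \<open>q\<close>, with \<open>N! = \<Gamma>(N + 1)\<close> and \<open>(x)\<^sub>s = \<Gamma>(x + s) / \<Gamma>(x)\<close>.
\<close>

definition type_I_const_real :: "real \<Rightarrow> real \<Rightarrow> real \<Rightarrow> nat \<Rightarrow> real \<Rightarrow> real" where
  "type_I_const_real b b' c p q =
     (1 - c) powr (b + real p + q + real p - 2) / c powr (real p + q - 1) *
     ((-1) ^ (p - 1) * Gamma (real p + q - 1) / (Gamma (real p) * Gamma q)) *
     (Gamma (b - b' - q + 1) / Gamma ((b - b' - q + 1) + (real p + q - 1)))"

lemma type_I_const_real_of_nat: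
  assumes "0 < c" "p \<ge> 1" "q \<ge> 1" "b - b' \<notin> \<int>"
  shows "type_I_const_real b b' c p (real q) = type_I_const b b' c p q"
proof -
  define z where "z = b - b' - real q + 1"
  have z: "z \<notin> \<int>\<^sub>\<le>\<^sub>0"
  proof
    assume "z \<in> \<int>\<^sub>\<le>\<^sub>0"
    then have "z \<in> \<int>" by (rule nonpos_Ints_Int)
    then have "z + real q - 1 \<in> \<int>" by (intro Ints_diff Ints_add) auto
    then show False using assms(4) by (simp add: z_def)
  qed
  have e: "real p + real q - 1 = real (p + q - 1)" using assms by (simp add: of_nat_diff)
  have g1: "Gamma (real (p + q - 1)) = fact (p + q - 2)"
  proof -
    have "real (p + q - 1) = 1 + real (p + q - 2)" using assms by (simp add: of_nat_diff)
    then show ?thesis by (simp only: Gamma_fact)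
  qed
  have g2: "Gamma (real k) = fact (k - 1)" if "k \<ge> 1" for k
  proof -
    have "real k = 1 + real (k - 1)" using that by (simp add: of_nat_diff)
    then show ?thesis by (metis Gamma_fact)
  qed
  have g3: "Gamma z / Gamma (z + real (p + q - 1)) = 1 / pochhammer z (p + q - 1)"
    using pochhammer_Gamma[OF z, of "p + q - 1"] by (simp add: field_simps)
  have g4: "c powr real (p + q - 1) = c ^ (p + q - 1)" using assms by (intro powr_realpow) auto
  show ?thesis
    unfolding type_I_const_real_def type_I_const_def z_def[symmetric] e g1
      g2[OF assms(2)] g2[OF assms(3)] g3 g4 by simp
qed

end

theory Submission
  imports Defs "HOL-Computational_Algebra.Formal_Power_Series"
begin

text \<open>
  Expand \<open>M\<^sub>a(x) = \<Sum>\<^sub>i d\<^sub>a\<^sub>,\<^sub>i (\<beta>\<^sub>a + x)\<^sub>i\<close>. The moment of \<open>(-k)\<^sub>j (\<beta>\<^sub>a + k)\<^sub>i\<close> against \<open>\<omega>\<^sub>a\<close> is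
  \<open>(c / (c - 1))\<^sup>j (\<beta>\<^sub>a + i)\<^sub>j\<close> times a factor independent of \<open>j\<close>, so the biorthogonality conditions say
  that a functional supported on the \<open>n\<^sub>1 + n\<^sub>2\<close> distinct nodes \<open>\<beta>\<^sub>a + i\<close> kills all polynomials of degree at
  most \<open>n\<^sub>1 + n\<^sub>2 - 2\<close>: it is a multiple of the divided difference, whence the \<open>d\<^sub>a\<^sub>,\<^sub>i\<close> in closed form.
  Chu--Vandermonde rewrites \<open>(\<beta>\<^sub>a + x)\<^sub>i\<close> in the basis \<open>(-x)\<^sub>l\<close>, and the remaining sum over \<open>i\<close> is
  transformed by expanding \<open>(1 - t E)\<^sup>n = ((1 - t) + t (1 - E))\<^sup>n\<close>, \<open>E\<close> the unit shift and \<open>t = 1 - c\<close>.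
\<close>

section \<open>Factorial moments of the weights\<close>

lemma meixner_weight_eq:
  assumes "b > 0"
  shows "meixner_weight b c k = pochhammer b k * c ^ k / fact k"
proof -
  have "b \<notin> \<int>\<^sub>\<le>\<^sub>0" using assms by (auto elim!: nonpos_Ints_cases)
  moreover have "Gamma (real k + 1) = fact k" using Gamma_fact[of k, where 'a = real] by (simp add: add.commute)
  ultimately show ?thesis
    unfolding meixner_weight_def by (simp add: pochhammer_Gamma)
qed

lemma negative_binomial_sums:
  fixes b c :: real
  assumes "0 < c" "c < 1"
  shows "(\<lambda>k. pochhammer b k * c ^ k / fact k) sums (1 - c) powr (- b)"
proof -
  have "(\<lambda>k. ((- b) gchoose k) * (- c) ^ k) sums (1 + (- c)) powr (- b)"
    by (rule gen_binomial_real) (use assms in auto)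
  moreover have "((- b) gchoose k) * (- c) ^ k = pochhammer b k * c ^ k / fact k" for k
    by (simp add: gbinomial_pochhammer power_minus[of c])
  ultimately show ?thesis by simp
qed

lemma pochhammer_minus_of_nat_add:
  "pochhammer (- real (r + j)) j = (- 1) ^ j * fact (r + j) / fact r"
proof -
  have "fact (r + j) = fact r * pochhammer (1 + real r) j"
    unfolding pochhammer_fact by (rule pochhammer_product')
  moreover have "pochhammer (- real (r + j)) j = (- 1) ^ j * pochhammer (1 + real r) j"
    unfolding pochhammer_minus by (simp add: add.commute)
  ultimately show ?thesis by simp
qed

text \<open>The factor (-k)_j vanishes for k < j. After the shift k = r + j it cancels against (r +
  j)! up to the sign (-1)^j, and what remains is the negative binomial series with parameter b +
  j.\<close>

lemma factorial_moment_sums: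
  fixes b c :: real
  assumes "0 < c" "c < 1"
  shows "(\<lambda>k. pochhammer (- real k) j * (pochhammer b k * c ^ k / fact k)) sums
           ((- c / (1 - c)) ^ j * pochhammer b j * (1 - c) powr (- b))"
proof -
  define f where "f k = pochhammer (- real k) j * (pochhammer b k * c ^ k / fact k)" for k
  have f0: "f i = 0" if "i < j" for i
    using that by (simp add: f_def pochhammer_of_nat_eq_0_iff)
  have "f (r + j) = ((- c) ^ j * pochhammer b j) * (pochhammer (b + real j) r * c ^ r / fact r)" for r
  proof -
    have "pochhammer b (r + j) = pochhammer b j * pochhammer (b + real j) r"
      using pochhammer_product'[of b j r] by (simp add: add.commute)
    then show ?thesis
      unfolding f_def pochhammer_minus_of_nat_add
      by (simp add: power_add power_minus[of c])
  qed
  then have "(\<lambda>r. f (r + j)) sums (((- c) ^ j * pochhammer b j) * (1 - c) powr (- (b + real j)))"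
    using sums_mult[OF negative_binomial_sums[OF assms, of "b + real j"]] by presburger
  then have "f sums (((- c) ^ j * pochhammer b j) * (1 - c) powr (- (b + real j)))"
    using sums_zero_iff_shift[of j f] f0 by blast
  moreover have "(1 - c) powr (- (b + real j)) = (1 - c) powr (- b) / (1 - c) ^ j"
    using assms by (simp add: powr_diff powr_realpow)
  moreover have "(- c / (1 - c)) ^ j = (- c) ^ j / (1 - c) ^ j" by (rule power_divide)
  ultimately show ?thesis
    unfolding f_def by (simp only: mult_ac times_divide_eq_left times_divide_eq_right)
qed

text \<open>From (b)_i (b + i)_k = (b)_k (b + k)_i it follows that multiplying the weight by (b +
  k)_i raises its parameter from b to b + i, up to a constant. The index j then enters only through
  a power and the value of (s)_j at the node s = b + i.\<close>

lemma meixner_moment_sums: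
  assumes "b > 0" "0 < c" "c < 1"
  shows "(\<lambda>k. pochhammer (- real k) j * (pochhammer (b + real k) i * meixner_weight b c k)) sums
           ((- c / (1 - c)) ^ j * (pochhammer b i * pochhammer (b + real i) j / (1 - c) ^ i
              * (1 - c) powr (- b)))"
proof -
  have "pochhammer b i * (pochhammer (- real k) j * (pochhammer (b + real i) k * c ^ k / fact k)) =
        pochhammer (- real k) j * (pochhammer (b + real k) i * meixner_weight b c k)" for k
  proof -
    have "pochhammer b i * pochhammer (b + real i) k = pochhammer b k * pochhammer (b + real k) i"
      using pochhammer_product'[of b i k] pochhammer_product'[of b k i] by (simp add: add.commute)
    then show ?thesis unfolding meixner_weight_eq[OF assms(1)] by (simp add: algebra_simps)
  qed
  moreover have "(1 - c) powr (- (b + real i)) = (1 - c) powr (- b) / (1 - c) ^ i"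
    using assms by (simp add: powr_diff powr_realpow)
  moreover note sums_mult[OF factorial_moment_sums[OF assms(2,3), of j "b + real i"], of "pochhammer b i"]
  ultimately show ?thesis by (simp only: mult_ac times_divide_eq_left times_divide_eq_right)
qed

section \<open>Expansions in Newton, rising and falling factorial bases\<close>

text \<open>Repeated synthetic division by x - z r peels off one coefficient at a time. The top
  coefficient is recorded because it alone meets the highest moment, where the normalisation
  sits.\<close>

lemma newton_basis:
  fixes P :: "'a::field poly"
  assumes "degree P \<le> n"
  shows "\<exists>d. d n = coeff P n \<and> (\<forall>x. poly P x = (\<Sum>i\<le>n. d i * (\<Prod>r<i. x - z r)))"
  using assms
proof (induction n arbitrary: P z)
  case 0
  then have "degree P = 0" by simp
  then obtain a where "P = [:a:]" by (rule degree_eq_zeroE)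
  then show ?case
    by (intro exI[of _ "\<lambda>_. a"]) simp
next
  case (Suc n)
  define Q where "Q = synthetic_div P (z 0)"
  have PQ: "P = [:- z 0, 1:] * Q + [:poly P (z 0):]"
    unfolding Q_def by (rule synthetic_div_correct'[symmetric])
  have "degree Q \<le> n" using Suc.prems by (simp add: Q_def degree_synthetic_div)
  from Suc.IH[OF this, of "\<lambda>r. z (Suc r)"] obtain d where
    d: "d n = coeff Q n" "\<And>x. poly Q x = (\<Sum>i\<le>n. d i * (\<Prod>r<i. x - z (Suc r)))" by blast
  have lead: "coeff P (Suc n) = coeff Q n"
  proof -
    have "coeff Q (Suc n) = 0" using \<open>degree Q \<le> n\<close> by (simp add: coeff_eq_0)
    then show ?thesis by (subst PQ) simp
  qed
  define e where "e i = (case i of 0 \<Rightarrow> poly P (z 0) | Suc i \<Rightarrow> d i)" for i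
  have "poly P x = (\<Sum>i\<le>Suc n. e i * (\<Prod>r<i. x - z r))" for x
  proof -
    have "poly P x = poly P (z 0) + (x - z 0) * poly Q x"
      by (subst PQ) (simp add: algebra_simps)
    also have "\<dots> = (\<Sum>i\<le>Suc n. e i * (\<Prod>r<i. x - z r))"
      unfolding sum.atMost_Suc_shift d(2)
      by (simp add: e_def prod.lessThan_Suc_shift sum_distrib_left mult_ac del: prod.lessThan_Suc)
    finally show ?thesis .
  qed
  then show ?case using lead d(1) by (intro exI[of _ e]) (simp add: e_def)
qed

lemma rising_basis:
  fixes P :: "real poly"
  assumes "degree P \<le> n"
  shows "\<exists>d. d n = coeff P n \<and> (\<forall>x. poly P x = (\<Sum>i\<le>n. d i * pochhammer (b + x) i))"
proof -
  have "pochhammer (b + x) i = (\<Prod>r<i. x - (- b - real r))" for x i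
    unfolding pochhammer_prod atLeast0LessThan by (intro prod.cong) auto
  then show ?thesis using newton_basis[OF assms, of "\<lambda>r. - b - real r"] by simp
qed

lemma rising_basis_less:
  fixes P :: "real poly"
  assumes "P = 0 \<or> degree P < n"
  shows "\<exists>d. \<forall>x. poly P x = (\<Sum>i<n. d i * pochhammer (b + x) i)"
proof (cases n)
  case 0
  then show ?thesis using assms by simp
next
  case (Suc m)
  then have "degree P \<le> m" using assms by auto
  then show ?thesis using rising_basis[of P m b] Suc by (auto simp: lessThan_Suc_atMost)
qed

lemma falling_basis:
  fixes P :: "real poly"
  assumes "degree P \<le> n"
  shows "\<exists>d. d n = (- 1) ^ n * coeff P n \<and> (\<forall>x. poly P x = (\<Sum>i\<le>n. d i * pochhammer (- x) i))"
proof -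
  have *: "(\<Prod>r<i. x - real r) = (- 1) ^ i * pochhammer (- x) i" for x i
  proof -
    have "pochhammer (- x) i = (\<Prod>r<i. (- 1) * (x - real r))"
      unfolding pochhammer_prod atLeast0LessThan by (intro prod.cong) auto
    then show ?thesis by (simp only: prod.distrib) (simp flip: mult.assoc power_mult_distrib)
  qed
  obtain d where d: "d n = coeff P n" "\<And>x. poly P x = (\<Sum>i\<le>n. d i * (\<Prod>r<i. x - real r))"
    using newton_basis[OF assms, of real] by blast
  show ?thesis
    by (intro exI[of _ "\<lambda>i. (- 1) ^ i * d i"]) (simp add: d * mult_ac)
qed

section \<open>Binomial sums and powers of 1 - tE, with E the unit shift\<close>

text \<open>Pascal's rule, read as (1 - tE)^(n+1) = (1 - tE)^n (1 - tE) applied to \<open>f\<close>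
  at \<open>A\<close>.\<close>

lemma alternating_sum_Suc:
  fixes f :: "real \<Rightarrow> real"
  shows "(\<Sum>r\<le>Suc n. real (Suc n choose r) * (- t) ^ r * f (A + real r)) =
         (\<Sum>r\<le>n. real (n choose r) * (- t) ^ r * (f (A + real r) - t * f (A + 1 + real r)))"
proof -
  \<comment> \<open>The added term has binomial coefficient 0; it gives the sum a range from which
    the term r = 0 can be split off.\<close>
  have s: "(\<Sum>r\<le>Suc n. real (n choose r) * (- t) ^ r * f (A + real r)) =
           (\<Sum>r\<le>n. real (n choose r) * (- t) ^ r * f (A + real r))" by simp
  have "(\<Sum>r\<le>Suc n. real (Suc n choose r) * (- t) ^ r * f (A + real r)) =
        f A + (\<Sum>r\<le>n. real (n choose Suc r) * (- t) ^ Suc r * f (A + real (Suc r))) +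
          (\<Sum>r\<le>n. real (n choose r) * (- t) ^ Suc r * f (A + real (Suc r)))"
    unfolding sum.atMost_Suc_shift
    by (simp add: sum.distrib[symmetric] distrib_left distrib_right add_ac del: power_Suc)
  also have "f A + (\<Sum>r\<le>n. real (n choose Suc r) * (- t) ^ Suc r * f (A + real (Suc r))) =
        (\<Sum>r\<le>n. real (n choose r) * (- t) ^ r * f (A + real r))"
    unfolding s[symmetric] sum.atMost_Suc_shift by simp
  finally show ?thesis
    by (simp add: sum.distrib[symmetric] right_diff_distrib mult_ac add_ac)
qed

text \<open>An n-th difference annihilates polynomials of degree j < n. Each difference lowers the
  degree by one: (z)_j - (z + 1)_j = -j (z + 1)_(j-1).\<close>

lemma alternating_sum_pochhammer:
  "j < n \<Longrightarrow> (\<Sum>r\<le>n. real (n choose r) * (- 1) ^ r * pochhammer (A + real r) j) = 0"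
proof (induction n arbitrary: j A)
  case (Suc n)
  show ?case
  proof (cases j)
    case 0
    then show ?thesis using alternating_sum_Suc[of n 1 "\<lambda>_. 1" A] by simp
  next
    case (Suc i)
    have "pochhammer z j - pochhammer (z + 1) j = - real j * pochhammer (z + 1) i" for z :: real
    proof -
      have "pochhammer z (Suc i) = z * pochhammer (z + 1) i" by (rule pochhammer_rec)
      moreover have "pochhammer (z + 1) (Suc i) = (z + 1 + real i) * pochhammer (z + 1) i"
        by (rule pochhammer_rec')
      ultimately show ?thesis by (simp add: Suc algebra_simps)
    qed
    from this[of "A + real r" for r]
    have "(\<Sum>r\<le>Suc n. real (Suc n choose r) * (- 1) ^ r * pochhammer (A + real r) j) =
          (\<Sum>r\<le>n. real (n choose r) * (- 1) ^ r * (- real j * pochhammer (A + 1 + real r) i))"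
      using alternating_sum_Suc[of n 1 "\<lambda>z. pochhammer z j" A] by (simp add: add_ac)
    also have "\<dots> = - real j * (\<Sum>r\<le>n. real (n choose r) * (- 1) ^ r * pochhammer (A + 1 + real r) i)"
      by (simp add: sum_distrib_left mult_ac)
    also have "\<dots> = 0" using Suc.IH[of i "A + 1"] Suc.prems Suc by simp
    finally show ?thesis .
  qed
qed simp

text \<open>The induction step uses that \<open>1 - E\<close> maps \<open>1 / (A)\<^sub>q\<close> to \<open>q / (A)\<^sub>q\<^sub>+\<^sub>1\<close>.\<close>

lemma binomial_sum_inverse_pochhammer:
  fixes A t :: real
  assumes "A \<notin> \<int>"
  shows "(\<Sum>r\<le>n. real (n choose r) * (- t) ^ r * (1 / pochhammer (A + real r) q)) =
         (\<Sum>m\<le>n. real (n choose m) * (1 - t) ^ m * t ^ (n - m) *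
            (pochhammer (real q) (n - m) / pochhammer A (q + (n - m))))"
  using assms
proof (induction n arbitrary: q)
  case 0
  then show ?case by simp
next
  case (Suc n)
  have nz: "pochhammer (A + real r) k \<noteq> 0" for r k
  proof
    assume "pochhammer (A + real r) k = 0"
    then obtain i where "A + real r = - real i" by (auto simp: pochhammer_eq_0_iff)
    then have "A = - real i - real r" by simp
    then show False using assms by (metis Ints_diff Ints_minus Ints_of_nat)
  qed
  \<comment> \<open>This is 1 - tE = (1 - t) + t (1 - E) applied to 1 / (z)_q. The second part
    raises \<open>q\<close> by one, which is why the induction keeps \<open>q\<close>
    arbitrary.\<close>
  have step: "1 / pochhammer (A + real r) q - t * (1 / pochhammer (A + 1 + real r) q) =
        (1 - t) * (1 / pochhammer (A + real r) q) + t * real q * (1 / pochhammer (A + real r) (Suc q))" for r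
  proof -
    define z where "z = A + real r"
    have n1: "pochhammer z q \<noteq> 0" "pochhammer (z + 1) q \<noteq> 0" "pochhammer z (Suc q) \<noteq> 0"
      using nz[of r] nz[of "Suc r"] by (auto simp: z_def add_ac)
    have "pochhammer z (Suc q) = z * pochhammer (z + 1) q" by (rule pochhammer_rec)
    moreover have "pochhammer z (Suc q) = (z + real q) * pochhammer z q" by (rule pochhammer_rec')
    moreover have "z \<noteq> 0" "z + real q \<noteq> 0" using n1 calculation by auto
    ultimately have "1 / pochhammer z q = (z + real q) / pochhammer z (Suc q)"
      "1 / pochhammer (z + 1) q = z / pochhammer z (Suc q)"
      using n1 by (simp_all add: divide_simps del: pochhammer_Suc)
    note this[unfolded divide_inverse]
    moreover have e: "A + 1 + real r = z + 1" by (simp add: z_def)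
    ultimately show ?thesis unfolding z_def[symmetric] e divide_inverse mult_1_left
      by (simp only:) (simp add: algebra_simps del: pochhammer_Suc)
  qed
  define T where "T m q = (1 - t) ^ m * t ^ (n - m) * (pochhammer (real q) (n - m) / pochhammer A (q + (n - m)))" for m q
  define S where "S q = (\<Sum>r\<le>n. real (n choose r) * (- t) ^ r * (1 / pochhammer (A + real r) q))" for q
  have IH: "S q = (\<Sum>m\<le>n. real (n choose m) * T m q)" for q
    unfolding S_def Suc.IH[OF assms] T_def by (simp add: mult.assoc)
  have "(\<Sum>r\<le>Suc n. real (Suc n choose r) * (- t) ^ r * (1 / pochhammer (A + real r) q)) =
        (1 - t) * S q + t * real q * S (Suc q)"
    unfolding alternating_sum_Suc[of n t "\<lambda>z. 1 / pochhammer z q" A] step S_def sum_distrib_left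
    by (simp only: distrib_left sum.distrib mult_ac)
  also have "\<dots> = (1 - t) * (\<Sum>m\<le>n. real (n choose m) * T m q) +
                   t * real q * (\<Sum>m\<le>n. real (n choose m) * T m (Suc q))"
    unfolding IH ..
  also have "\<dots> = (\<Sum>m\<le>Suc n. real (Suc n choose m) * (1 - t) ^ m * t ^ (Suc n - m) *
            (pochhammer (real q) (Suc n - m) / pochhammer A (q + (Suc n - m))))" (is "_ = (\<Sum>m\<le>Suc n. ?U m)")
  proof -
    \<comment> \<open>\<open>V m\<close> is the summand of the goal without its binomial
      coefficient. The first part of the recurrence moves m to m + 1, the second keeps m, so
      Pascal's rule joins them.\<close>
    define V where "V m = (1 - t) ^ m * t ^ (Suc n - m) * (pochhammer (real q) (Suc n - m) / pochhammer A (q + (Suc n - m)))" for m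
    have V1: "(1 - t) * T m q = V (Suc m)" for m by (simp add: T_def V_def)
    have V2: "t * real q * T m (Suc q) = V m" if "m \<le> n" for m
      using that by (simp add: T_def V_def Suc_diff_le pochhammer_rec[of "real q"] add_ac del: pochhammer_Suc)
    have "(\<Sum>m\<le>Suc n. ?U m) = (\<Sum>m\<le>Suc n. real (Suc n choose m) * V m)"
      by (simp add: V_def mult_ac)
    also have "\<dots> = (\<Sum>m\<le>n. real (n choose m) * V (Suc m)) + (V 0 + (\<Sum>m\<le>n. real (n choose Suc m) * V (Suc m)))"
      unfolding sum.atMost_Suc_shift by (simp add: sum.distrib algebra_simps)
    also have "V 0 + (\<Sum>m\<le>n. real (n choose Suc m) * V (Suc m)) = (\<Sum>m\<le>Suc n. real (n choose m) * V m)"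
      unfolding sum.atMost_Suc_shift by simp
    finally show ?thesis
      by (simp add: sum_distrib_left V1[symmetric] V2[symmetric] mult_ac)
  qed
  finally show ?case .
qed

section \<open>Existence of type II polynomials with index (n, 0)\<close>

lemma poly_pochhammer: "poly (pochhammer P n) x = pochhammer (poly P x) n"
  by (induction n) (simp_all add: pochhammer_rec' of_nat_poly)

lemma monic_pochhammer_linear:
  fixes b :: real
  shows "degree (pochhammer [:b, 1:] n) = n \<and> coeff (pochhammer [:b, 1:] n) n = 1"
proof (induction n)
  case (Suc n)
  have e: "pochhammer [:b, 1:] (Suc n) = [:b + real n, 1:] * pochhammer [:b, 1:] n"
    by (simp add: pochhammer_rec' of_nat_poly)
  have nz: "pochhammer [:b, 1:] n \<noteq> 0" using Suc.IH by auto
  have d: "degree (pochhammer [:b, 1:] (Suc n)) = Suc n"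
    unfolding e using Suc.IH nz by (subst degree_mult_eq) auto
  have "coeff (pochhammer [:b, 1:] (Suc n)) (Suc n) = lead_coeff ([:b + real n, 1:] * pochhammer [:b, 1:] n)"
    using d e by simp
  also have "\<dots> = 1" using Suc.IH by (simp only: lead_coeff_mult) simp
  finally show ?case using d by simp
qed simp

text \<open>The normalisation of the type I polynomials is quantified over type II polynomials, so
  it says something only once one of the right degree is exhibited. With second index 0 only the
  first weight imposes orthogonality, and an explicit sum suffices.\<close>

lemma meixner_type_II_exists:
  assumes "\<beta> 1 > 0" "0 < c" "c < 1"
  shows "\<exists>P. meixner_type_II \<beta> c (\<lambda>a. if a = 1 then n else 0) P"
proof -
  define b where "b = \<beta> 1"
  have b: "b > 0" using assms b_def by simp
  have pb: "pochhammer b l > 0" for l using b by (rule pochhammer_pos)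
  \<comment> \<open>The weights turn the moments into an \<open>n\<close>-th difference of a polynomial of degree \<open>j < n\<close>.\<close>
  define u where "u = (- 1) ^ n * pochhammer b n / (1 - c) ^ n"
  define w where "w l = u * (real (n choose l) * (- 1) ^ l * (1 - c) ^ l / pochhammer b l)" for l
  define P where "P = (\<Sum>l\<le>n. smult (w l) (pochhammer [:b, 1:] l))"
  \<comment> \<open>The constant \<open>u\<close> is chosen for this equation: it makes
    \<open>P\<close> monic, since the term l = n alone contributes to the coefficient of degree
    \<open>n\<close>.\<close>
  have wn: "w n = 1" using assms pb[of n] by (simp add: w_def u_def flip: power_mult_distrib)
  have "coeff P n = (\<Sum>l\<le>n. w l * coeff (pochhammer [:b, 1:] l) n)" by (simp add: P_def coeff_sum)
  also have "\<dots> = (\<Sum>l\<le>n. if l = n then 1 else 0)"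
    using monic_pochhammer_linear[of b] wn by (intro sum.cong refl) (auto simp: coeff_eq_0)
  finally have cP: "coeff P n = 1" by simp
  have "degree P \<le> n"
    unfolding P_def using monic_pochhammer_linear[of b]
    by (intro degree_sum_le) (auto intro: order_trans[OF degree_smult_le])
  then have dP: "degree P = n" using cP le_degree[of P n] by simp
  have "(\<lambda>k. pochhammer (- real k) j * poly P (real k) * meixner_weight b c k) sums 0" if "j < n" for j
  proof -
    have "(\<lambda>k. \<Sum>l\<le>n. w l * (pochhammer (- real k) j * (pochhammer (b + real k) l * meixner_weight b c k))) sums
      (\<Sum>l\<le>n. w l * ((- c / (1 - c)) ^ j * (pochhammer b l * pochhammer (b + real l) j / (1 - c) ^ l
              * (1 - c) powr (- b))))"
      by (intro sums_sum sums_mult meixner_moment_sums b assms)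
    moreover have "w l * ((- c / (1 - c)) ^ j * (pochhammer b l * pochhammer (b + real l) j / (1 - c) ^ l
              * (1 - c) powr (- b))) = (u * (- c / (1 - c)) ^ j * (1 - c) powr (- b)) *
                (real (n choose l) * (- 1) ^ l * pochhammer (b + real l) j)" for l
      using pb[of l] assms by (simp add: w_def)
    moreover have "(\<Sum>l\<le>n. w l * (pochhammer (- real k) j * (pochhammer (b + real k) l * meixner_weight b c k))) =
        pochhammer (- real k) j * poly P (real k) * meixner_weight b c k" for k
      by (simp add: P_def poly_sum poly_pochhammer sum_distrib_left sum_distrib_right mult_ac)
    ultimately show ?thesis
      using alternating_sum_pochhammer[OF that, of b] by (simp only: sum_distrib_left[symmetric]) simp
  qed
  then show ?thesis
    using cP dP by (intro exI[of _ P]) (auto simp: meixner_type_II_def b_def)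
qed

section \<open>Divided differences and the coefficients in closed form\<close>

text \<open>The factors with l < i give i!, the \<open>m\<close> factors with l > i give (-1)^m m!.
  This is the part of the divided-difference denominator that comes from nodes in the same unit
  progression.\<close>

lemma prod_differences:
  "(\<Prod>l\<in>{..<Suc (i + m)} - {i}. real i - real l) = (- 1) ^ m * (fact i * fact m)"
proof (induction m)
  case 0
  have "{..<Suc i} - {i} = {..<i}" by auto
  moreover have "(\<Prod>l<i. real i - real l) = fact i"
  proof -
    have "(\<Prod>l<i. real i - real l) = (\<Prod>l<i. real (i - Suc l) + 1)"
      by (intro prod.cong) (auto simp: of_nat_diff)
    also have "\<dots> = (\<Prod>l<i. real l + 1)" by (rule prod.nat_diff_reindex)
    also have "\<dots> = fact i" by (induction i) simp_all
    finally show ?thesis .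
  qed
  ultimately show ?case by simp
next
  case (Suc m)
  have "{..<Suc (i + Suc m)} - {i} = insert (Suc (i + m)) ({..<Suc (i + m)} - {i})" by auto
  then show ?case using Suc.IH by (simp add: algebra_simps)
qed

lemma prod_shifted_differences:
  "(\<Prod>l<q. s - (z + real l)) = pochhammer (s - z - real q + 1) q"
proof -
  have "(\<Prod>l<q. s - (z + real l)) = (\<Prod>l<q. s - (z + real (q - Suc l)))"
    by (rule prod.nat_diff_reindex[symmetric])
  also have "\<dots> = pochhammer (s - z - real q + 1) q"
    unfolding pochhammer_prod atLeast0LessThan
    by (intro prod.cong) (auto simp: of_nat_diff algebra_simps)
  finally show ?thesis .
qed

text \<open>\<open>H j\<close> is a functional with masses at the nodes b + i and b' + i, evaluated
  at (s)_j. It is tested on the monic polynomial of degree p + q - 1 that vanishes at all nodes but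
  b + i0: the expansion in the (s)_j leaves the top moment only, the evaluation at the nodes leaves
  \<open>D i0\<close> only. The result is stated without division; nonvanishing of the factor is
  settled where it is applied.\<close>

lemma factorial_moments_determine:
  fixes D E :: "nat \<Rightarrow> real"
  assumes "i0 < p"
    and H: "\<And>j. H j = (\<Sum>i<p. D i * pochhammer (b + real i) j) + (\<Sum>i<q. E i * pochhammer (b' + real i) j)"
    and low: "\<And>j. j + 2 \<le> p + q \<Longrightarrow> H j = 0"
  shows "D i0 * ((- 1) ^ (p - 1 - i0) * (fact i0 * fact (p - 1 - i0)) *
           pochhammer (b - b' + real i0 - real q + 1) q) = H (p + q - 1)"
proof -
  define R1 where "R1 = (\<Prod>l\<in>{..<p} - {i0}. [:- (b + real l), 1:])"
  define R2 where "R2 = (\<Prod>l<q. [:- (b' + real l), 1:])"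
  define N where "N = p + q - 1"
  have "degree R1 = p - 1" unfolding R1_def
    by (subst degree_prod_eq_sum_degree) (use assms in auto)
  moreover have "degree R2 = q" unfolding R2_def
    by (subst degree_prod_eq_sum_degree) auto
  moreover have l1: "lead_coeff R1 = 1" "lead_coeff R2 = 1"
    unfolding R1_def R2_def lead_coeff_prod by simp_all
  moreover have "R1 \<noteq> 0" "R2 \<noteq> 0" using l1 by auto
  ultimately have deg: "degree (R1 * R2) = N" using \<open>i0 < p\<close> by (simp add: degree_mult_eq N_def)
  then have "coeff (R1 * R2) N = 1" using l1 lead_coeff_mult[of R1 R2] by simp
  with rising_basis[of "R1 * R2" N 0] deg obtain d where
    d: "d N = 1" "\<And>s. poly (R1 * R2) s = (\<Sum>j\<le>N. d j * pochhammer s j)" by auto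
  have "(\<Sum>i<p. D i * poly (R1 * R2) (b + real i)) + (\<Sum>i<q. E i * poly (R1 * R2) (b' + real i))
        = (\<Sum>j\<le>N. d j * H j)"
  proof -
    have s: "(\<Sum>i<m. F i * poly (R1 * R2) (z i)) = (\<Sum>j\<le>N. d j * (\<Sum>i<m. F i * pochhammer (z i) j))"
      for F z and m :: nat
      unfolding d(2) sum_distrib_left by (subst sum.swap) (simp add: mult_ac)
    show ?thesis unfolding s H by (simp add: sum.distrib distrib_left)
  qed
  also have "\<dots> = (\<Sum>j\<le>N. if j = N then H N else 0)"
    using low d(1) \<open>i0 < p\<close> by (intro sum.cong refl) (auto simp: N_def)
  also have "\<dots> = H N" by simp
  also have "(\<Sum>i<q. E i * poly (R1 * R2) (b' + real i)) = 0"
    by (rule sum.neutral) (auto simp: R2_def poly_prod)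
  also have "(\<Sum>i<p. D i * poly (R1 * R2) (b + real i)) = (\<Sum>i<p. if i = i0 then D i0 * poly (R1 * R2) (b + real i0) else 0)"
    by (intro sum.cong refl) (auto simp: R1_def poly_prod)
  also have "\<dots> = D i0 * (poly R1 (b + real i0) * poly R2 (b + real i0))" using \<open>i0 < p\<close> by simp
  also have "poly R1 (b + real i0) = (- 1) ^ (p - 1 - i0) * (fact i0 * fact (p - 1 - i0))"
    using prod_differences[of i0 "p - 1 - i0"] \<open>i0 < p\<close> by (simp add: R1_def poly_prod)
  also have "poly R2 (b + real i0) = pochhammer (b - b' + real i0 - real q + 1) q"
    using prod_shifted_differences[of "b + real i0" b' q]
    by (simp add: R2_def poly_prod algebra_simps)
  finally show ?thesis by (simp add: N_def)
qed

lemma pochhammer_nonint_nonzero: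
  fixes z :: real
  assumes "z \<notin> \<int>"
  shows "pochhammer z k \<noteq> 0"
proof
  assume "pochhammer z k = 0"
  then obtain i where "z = - real i" by (auto simp: pochhammer_eq_0_iff)
  then show False using assms by simp
qed

lemma not_Ints_add:
  fixes z y :: real
  assumes "z \<notin> \<int>" "y \<in> \<int>"
  shows "z + y \<notin> \<int>"
  using assms Ints_diff[of "z + y" y] by auto

text \<open>Dividing the moments by (-c/(1-c))^j gives the functional \<open>H\<close> on the nodes,
  whose masses are then read off. The value (-1)^(p+q-1) in \<open>top\<close> is the normalisation
  against a monic polynomial, since (-k)_N has leading coefficient (-1)^N.\<close>

lemma type_I_explicit:
  fixes P Q :: "real poly"
  assumes "b > 0" "b' > 0" "b - b' \<notin> \<int>" "0 < c" "c < 1"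
    and "P = 0 \<or> degree P < p" "Q = 0 \<or> degree Q < q" "p \<ge> 1"
    and low: "\<And>j. j + 2 \<le> p + q \<Longrightarrow> (\<lambda>k. pochhammer (- real k) j *
        (poly P (real k) * meixner_weight b c k + poly Q (real k) * meixner_weight b' c k)) sums 0"
    and top: "(\<lambda>k. pochhammer (- real k) (p + q - 1) *
        (poly P (real k) * meixner_weight b c k + poly Q (real k) * meixner_weight b' c k)) sums (- 1) ^ (p + q - 1)"
  shows "poly P x = ((1 - c) / c) ^ (p + q - 1) * (1 - c) powr b *
     (\<Sum>i<p. (1 - c) ^ i * (- 1) ^ (p - 1 - i) /
        (fact i * fact (p - 1 - i) * pochhammer (b - b' + real i - real q + 1) q) *
        (pochhammer (b + x) i / pochhammer b i))"
proof -
  obtain d where d: "\<And>x. poly P x = (\<Sum>i<p. d i * pochhammer (b + x) i)"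
    using rising_basis_less[OF assms(6)] by blast
  obtain e where e: "\<And>x. poly Q x = (\<Sum>i<q. e i * pochhammer (b' + x) i)"
    using rising_basis_less[OF assms(7)] by blast
  \<comment> \<open>\<open>D\<close> and \<open>E\<close> absorb every factor of the moments that
    does not depend on j.\<close>
  define D where "D i = d i * (pochhammer b i / (1 - c) ^ i * (1 - c) powr (- b))" for i
  define E where "E i = e i * (pochhammer b' i / (1 - c) ^ i * (1 - c) powr (- b'))" for i
  define H where "H j = (\<Sum>i<p. D i * pochhammer (b + real i) j) + (\<Sum>i<q. E i * pochhammer (b' + real i) j)" for j
  have half: "(\<lambda>k. pochhammer (- real k) j * ((\<Sum>i<m. f i * pochhammer (z + real k) i) * meixner_weight z c k)) sums
     ((- c / (1 - c)) ^ j * (\<Sum>i<m. f i * (pochhammer z i / (1 - c) ^ i * (1 - c) powr (- z)) * pochhammer (z + real i) j))"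
    if "z > 0" for z j f m
  proof -
    have "(\<lambda>k. \<Sum>i<m. f i * (pochhammer (- real k) j * (pochhammer (z + real k) i * meixner_weight z c k))) sums
      (\<Sum>i<m. f i * ((- c / (1 - c)) ^ j * (pochhammer z i * pochhammer (z + real i) j / (1 - c) ^ i
              * (1 - c) powr (- z))))"
      by (intro sums_sum sums_mult meixner_moment_sums that assms)
    then show ?thesis by (simp add: sum_distrib_left sum_distrib_right mult_ac)
  qed
  have mom: "(\<lambda>k. pochhammer (- real k) j *
        (poly P (real k) * meixner_weight b c k + poly Q (real k) * meixner_weight b' c k)) sums
        ((- c / (1 - c)) ^ j * H j)" for j
    using sums_add[OF half[OF assms(1), where j = j and m = p and f = d] half[OF assms(2), where j = j and m = q and f = e]]
    unfolding d e H_def D_def E_def by (simp only: distrib_left)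
  have cc: "(- c / (1 - c)) ^ j \<noteq> 0" for j using assms by simp
  have H0: "H j = 0" if "j + 2 \<le> p + q" for j
    using sums_unique2[OF mom low[OF that]] cc[of j] by (metis mult_eq_0_iff)
  have "(- c / (1 - c)) ^ (p + q - 1) * H (p + q - 1) = (- 1) ^ (p + q - 1)"
    by (rule sums_unique2[OF mom top])
  moreover have "((1 - c) / c) ^ (p + q - 1) * (- c / (1 - c)) ^ (p + q - 1) = (- 1) ^ (p + q - 1)"
    using assms by (simp flip: power_mult_distrib)
  ultimately have H1: "H (p + q - 1) = ((1 - c) / c) ^ (p + q - 1)"
    using cc[of "p + q - 1"] by (metis mult.commute mult_cancel_left)
  have "d i * pochhammer (b + x) i = ((1 - c) / c) ^ (p + q - 1) * (1 - c) powr b *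
      ((1 - c) ^ i * (- 1) ^ (p - 1 - i) /
        (fact i * fact (p - 1 - i) * pochhammer (b - b' + real i - real q + 1) q) *
        (pochhammer (b + x) i / pochhammer b i))" if "i < p" for i
  proof -
    \<comment> \<open>Up to sign, \<open>W\<close> is the product of the differences between b + i
      and all other nodes. It is nonzero because b - b' is not an integer.\<close>
    define W where "W = fact i * fact (p - 1 - i) * pochhammer (b - b' + real i - real q + 1) q"
    have "b - b' + (real i - real q + 1) \<notin> \<int>"
      by (rule not_Ints_add[OF assms(3)]) (intro Ints_add Ints_diff; simp)
    then have "b - b' + real i - real q + 1 \<notin> \<int>" by (simp add: algebra_simps)
    then have W: "W \<noteq> 0" by (simp add: W_def pochhammer_nonint_nonzero)
    have pb: "pochhammer b i > 0" using assms(1) by (rule pochhammer_pos)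
    have "D i * ((- 1) ^ (p - 1 - i) * W) = ((1 - c) / c) ^ (p + q - 1)"
      using factorial_moments_determine[OF that H_def H0] H1 unfolding W_def by (simp only: mult_ac)
    then have "D i = ((1 - c) / c) ^ (p + q - 1) * (- 1) ^ (p - 1 - i) / W"
      using W by (simp add: eq_divide_eq) (metis (no_types, lifting) mult.assoc mult.commute mult.right_neutral minus_one_mult_self)
    moreover have "d i = D i * (1 - c) ^ i * (1 - c) powr b / pochhammer b i"
      using pb assms by (simp add: D_def powr_minus field_simps)
    ultimately show ?thesis unfolding W_def[symmetric] by (simp add: mult_ac)
  qed
  then show ?thesis unfolding d by (simp add: sum_distrib_left)
qed

section \<open>The double sum and its form that is regular at q = 0\<close>

lemma triangle_sum_swap:
  fixes f :: "nat \<Rightarrow> nat \<Rightarrow> 'a::comm_monoid_add"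
  shows "(\<Sum>i<p. \<Sum>l\<le>i. f i l) = (\<Sum>l<p. \<Sum>r<p - l. f (l + r) l)"
proof -
  have "(\<Sum>i<p. \<Sum>l\<le>i. f i l) = (\<Sum>(i, l)\<in>Sigma {..<p} (\<lambda>i. {..i}). f i l)"
    by (simp add: sum.Sigma)
  also have "\<dots> = (\<Sum>(l, r)\<in>Sigma {..<p} (\<lambda>l. {..<p - l}). f (l + r) l)"
    by (rule sum.reindex_bij_witness[of _ "\<lambda>(l, r). (l + r, l)" "\<lambda>(i, l). (l, i - l)"]) auto
  finally show ?thesis by (simp add: sum.Sigma)
qed

lemma pochhammer_one_minus_of_nat:
  assumes "k < p"
  shows "pochhammer (- real p + 1) k = (- 1) ^ k * fact (p - 1) / fact (p - 1 - k)"
proof -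
  have "p - 1 - k + k = p - 1" using assms by simp
  moreover from assms have "- real p + 1 = - real (p - 1)" by (simp add: of_nat_diff)
  ultimately show ?thesis using pochhammer_minus_of_nat_add[of "p - 1 - k" k] by (simp only:)
qed

text \<open>
  The constant times the sum, after the cancellation
  \<open>(q)\<^sub>p\<^sub>-\<^sub>1 / (2 - p - q)\<^sub>k = (-1)\<^sup>k (q)\<^sub>p\<^sub>-\<^sub>1\<^sub>-\<^sub>k\<close> that removes the indeterminacy at \<open>q = 0\<close>.
\<close>

definition type_I_regular :: "real \<Rightarrow> real \<Rightarrow> real \<Rightarrow> nat \<Rightarrow> real \<Rightarrow> real \<Rightarrow> real" where
  "type_I_regular b b' c p q x =
     (1 - c) powr (b + real p + q + real p - 2) / c powr (real p + q - 1) * (- 1) ^ (p - 1) *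
     (Gamma (b - b' - q + 1) / Gamma (b - b' + real p)) *
     (\<Sum>l<p. pochhammer (b - b' - q + 1) l / (fact l * pochhammer b l) * pochhammer (- x) l *
        (\<Sum>m<p - l. pochhammer (b' - b - real p + 1) m * pochhammer q (p - 1 - l - m) /
           (fact m * fact (p - 1 - l - m)) * (c / (c - 1)) ^ m))"

lemma type_I_const_real_times_sum:
  assumes "p \<ge> 1" "q \<notin> \<int>\<^sub>\<le>\<^sub>0"
  shows "type_I_const_real b b' c p q * type_I_sum b b' c p q x = type_I_regular b b' c p q x"
proof -
  define C where "C = (1 - c) powr (b + real p + q + real p - 2) / c powr (real p + q - 1) * (- 1) ^ (p - 1) *
     (Gamma (b - b' - q + 1) / Gamma (b - b' + real p))"
  have Gp: "Gamma (real p) = fact (p - 1)"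
    using Gamma_fact[of "p - 1", where 'a = real] assms(1) by (simp add: of_nat_diff)
  have "Gamma (real p + q - 1) = pochhammer q (p - 1) * Gamma q"
    using pochhammer_Gamma[OF assms(2), of "p - 1"] assms Gamma_eq_zero_iff[of q]
    by (simp add: of_nat_diff algebra_simps)
  then have e1: "Gamma (real p + q - 1) / (Gamma (real p) * Gamma q) = pochhammer q (p - 1) / fact (p - 1)"
    using assms Gamma_eq_zero_iff[of q] by (simp add: Gp)
  have e2: "b - b' - q + 1 + (real p + q - 1) = b - b' + real p" by simp
  have K: "type_I_const_real b b' c p q = C * (pochhammer q (p - 1) / fact (p - 1))"
    unfolding type_I_const_real_def C_def e2 e1[symmetric] by (simp add: mult_ac)
  \<comment> \<open>Read backwards, (2 - p - q)_k is up to sign the last k factors of (q)_(p-1), so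
    the quotient leaves the first p - 1 - k. The sign cancels against that of (1 - p)_k.\<close>
  have key: "pochhammer q (p - 1) / fact (p - 1) * (pochhammer (- real p + 1) k / pochhammer (- real p - q + 2) k)
      = pochhammer q (p - 1 - k) / fact (p - 1 - k)" if "k < p" for k
  proof -
    have nz: "pochhammer (q + real (p - 1 - k)) k \<noteq> 0"
    proof
      assume "pochhammer (q + real (p - 1 - k)) k = 0"
      then obtain i where "q + real (p - 1 - k) = - real i" by (auto simp: pochhammer_eq_0_iff)
      then have "q = - of_nat (i + (p - 1 - k))" by simp
      then have "q \<in> \<int>\<^sub>\<le>\<^sub>0" by (simp only: minus_of_nat_in_nonpos_Ints)
      then show False using assms(2) by simp
    qed
    have e3: "- real p - q + 2 = - (real p + q - 2)" by simp
    have e4: "real p + q - 2 - real k + 1 = q + real (p - 1 - k)"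
      using that by (simp add: of_nat_diff)
    have d: "pochhammer (- real p - q + 2) k = (- 1) ^ k * pochhammer (q + real (p - 1 - k)) k"
      unfolding e3 pochhammer_minus e4 ..
    have "pochhammer q (p - 1) = pochhammer q (p - 1 - k) * pochhammer (q + real (p - 1 - k)) k"
      using pochhammer_product'[of q "p - 1 - k" k] that by simp
    then show ?thesis unfolding d pochhammer_one_minus_of_nat[OF that] using nz by simp
  qed
  have "pochhammer q (p - 1) / fact (p - 1) * type_I_sum b b' c p q x =
     (\<Sum>l<p. pochhammer (b - b' - q + 1) l / (fact l * pochhammer b l) * pochhammer (- x) l *
        (\<Sum>m<p - l. pochhammer (b' - b - real p + 1) m / fact m * (c / (c - 1)) ^ m *
           (pochhammer q (p - 1) / fact (p - 1) *
            (pochhammer (- real p + 1) (l + m) / pochhammer (- real p - q + 2) (l + m)))))"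
    unfolding type_I_sum_def by (simp add: sum_distrib_left mult_ac)
  also have "\<dots> = (\<Sum>l<p. pochhammer (b - b' - q + 1) l / (fact l * pochhammer b l) * pochhammer (- x) l *
        (\<Sum>m<p - l. pochhammer (b' - b - real p + 1) m * pochhammer q (p - 1 - l - m) /
           (fact m * fact (p - 1 - l - m)) * (c / (c - 1)) ^ m))"
  proof (rule sum.cong[OF refl], rule arg_cong2[where f = "(*)", OF refl], rule sum.cong[OF refl])
    fix l m assume "l \<in> {..<p}" "m \<in> {..<p - l}"
    then have "l + m < p" by auto
    show "pochhammer (b' - b - real p + 1) m / fact m * (c / (c - 1)) ^ m *
           (pochhammer q (p - 1) / fact (p - 1) *
            (pochhammer (- real p + 1) (l + m) / pochhammer (- real p - q + 2) (l + m))) =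
          pochhammer (b' - b - real p + 1) m * pochhammer q (p - 1 - l - m) /
           (fact m * fact (p - 1 - l - m)) * (c / (c - 1)) ^ m"
      unfolding key[OF \<open>l + m < p\<close>] diff_diff_left by simp
  qed
  finally show ?thesis unfolding K type_I_regular_def C_def[symmetric] mult.assoc[of C] by (simp only:)
qed

text \<open>The numerator (1 - p)_(l+m) vanishes as soon as l + m >= p, so the infinite sum is
  supported on the finite triangle \<open>T\<close>; there the terms agree one by one.\<close>

lemma type_I_series_eq_sum:
  assumes "p \<ge> 1"
  shows "type_I_series b b' c p q x = type_I_sum b b' c p q x"
proof -
  define T where "T = Sigma {..<p} (\<lambda>l. {..<p - l})"
  define f where "f = (\<lambda>(l, m). pochs [- real p + 1] (l + m) / pochs [- real p - q + 2] (l + m) *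
      (pochs [- x, b - b' - q + 1] l / pochs [b] l) *
      (pochs [b' - b - real p + 1] m / pochs [] m) * (1 ^ l / fact l) * ((c / (c - 1)) ^ m / fact m))"
  have "f z = 0" if "z \<notin> T" for z
  proof -
    obtain l m where z: "z = (l, m)" by fastforce
    with that have "l + m \<ge> p" by (auto simp: T_def)
    then have "pochhammer (- real (p - 1)) (l + m) = 0"
      using assms by (simp only: pochhammer_of_nat_eq_0_iff)
    then show ?thesis using assms by (simp add: z f_def pochs_def of_nat_diff)
  qed
  then have "infsum f UNIV = infsum f T" by (intro infsum_cong_neutral) auto
  also have "\<dots> = sum f T" by (simp add: T_def)
  also have "\<dots> = (\<Sum>l<p. \<Sum>m<p - l. f (l, m))" unfolding T_def by (simp add: sum.Sigma)
  also have "\<dots> = type_I_sum b b' c p q x"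
    unfolding type_I_sum_def f_def by (simp add: pochs_def sum_distrib_left mult_ac)
  finally show ?thesis by (simp add: type_I_series_def kampe_de_feriet_def f_def)
qed

section \<open>From the closed-form coefficients to the double sum\<close>

lemma pochhammer_Vandermonde_ratio:
  fixes b x :: real and i :: nat
  assumes "b > 0"
  shows "pochhammer (b + x) i / pochhammer b i =
           (\<Sum>l\<le>i. (- 1) ^ l * real (i choose l) * pochhammer (- x) l / pochhammer b l)"
proof -
  have "\<forall>j\<in>{0..<i}. b \<noteq> - of_nat j" using assms by auto
  from Vandermonde_pochhammer[OF this, of "- x"]
  have "pochhammer (b + x) i / pochhammer b i =
      (\<Sum>l\<le>i. pochhammer (- x) l * pochhammer (- real i) l / (fact l * pochhammer b l))"
    by (simp add: atMost_atLeast0)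
  also have "\<dots> = (\<Sum>l\<le>i. (- 1) ^ l * real (i choose l) * pochhammer (- x) l / pochhammer b l)"
  proof (intro sum.cong refl)
    fix l assume "l \<in> {..i}"
    then have "pochhammer (- real i) l = (- 1) ^ l * real (i choose l) * fact l"
      using pochhammer_minus_of_nat_add[of "i - l" l] by (simp add: binomial_fact)
    then show "pochhammer (- x) l * pochhammer (- real i) l / (fact l * pochhammer b l) =
      (- 1) ^ l * real (i choose l) * pochhammer (- x) l / pochhammer b l" by simp
  qed
  finally show ?thesis .
qed

text \<open>Chu-Vandermonde turns the right-hand side into a double sum. With the order exchanged,
  the coefficient of (-x)_l is a binomial sum over shifted reciprocals 1 / (z + l + r)_q, and the
  shift-operator identity with t = 1 - c transforms it into the sum over m.\<close>

lemma type_I_regular_of_nat: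
  assumes "b > 0" "b - b' \<notin> \<int>" "0 < c" "c < 1" "p \<ge> 1"
  shows "type_I_regular b b' c p (real q) x = ((1 - c) / c) ^ (p + q - 1) * (1 - c) powr b *
     (\<Sum>i<p. (1 - c) ^ i * (- 1) ^ (p - 1 - i) /
        (fact i * fact (p - 1 - i) * pochhammer (b - b' + real i - real q + 1) q) *
        (pochhammer (b + x) i / pochhammer b i))"
proof -
  define z where "z = b - b' - real q + 1"
  have nint: "z + real l \<notin> \<int>" for l
  proof -
    have "b - b' + (real l - real q + 1) \<notin> \<int>"
      by (rule not_Ints_add[OF assms(2)]) (intro Ints_add Ints_diff; simp)
    then show ?thesis by (simp add: z_def algebra_simps)
  qed
  have nz: "pochhammer (z + real l) k \<noteq> 0" for l k
    using nint by (rule pochhammer_nonint_nonzero)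
  have nz0: "pochhammer z k \<noteq> 0" for k using nz[of 0 k] by simp
  define C where "C = ((1 - c) / c) ^ (p + q - 1) * (1 - c) powr b"
  define X where "X l = pochhammer (- x) l / (fact l * pochhammer b l)" for l
  have "(\<Sum>i<p. (1 - c) ^ i * (- 1) ^ (p - 1 - i) /
        (fact i * fact (p - 1 - i) * pochhammer (b - b' + real i - real q + 1) q) *
        (pochhammer (b + x) i / pochhammer b i)) =
     (\<Sum>i<p. \<Sum>l\<le>i. X l * ((1 - c) ^ i * (- 1) ^ (p - 1 - i + l) /
        (fact (i - l) * fact (p - 1 - i) * pochhammer (z + real i) q)))"
    unfolding pochhammer_Vandermonde_ratio[OF assms(1)] sum_distrib_left
  proof (intro sum.cong refl)
    fix i l :: nat assume "l \<in> {..i}"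
    then have "real (i choose l) = fact i / (fact l * fact (i - l))" by (simp add: binomial_fact)
    moreover have e: "b - b' + real i - real q + 1 = z + real i" by (simp add: z_def)
    ultimately show "(1 - c) ^ i * (- 1) ^ (p - 1 - i) /
        (fact i * fact (p - 1 - i) * pochhammer (b - b' + real i - real q + 1) q) *
        ((- 1) ^ l * real (i choose l) * pochhammer (- x) l / pochhammer b l) =
        X l * ((1 - c) ^ i * (- 1) ^ (p - 1 - i + l) /
        (fact (i - l) * fact (p - 1 - i) * pochhammer (z + real i) q))"
      unfolding e by (simp add: X_def power_add mult_ac)
  qed
  also have "\<dots> = (\<Sum>l<p. X l * (\<Sum>r<p - l. (1 - c) ^ (l + r) * (- 1) ^ (p - 1 - (l + r) + l) /
        (fact r * fact (p - 1 - (l + r)) * pochhammer (z + real (l + r)) q)))"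
    by (simp add: triangle_sum_swap sum_distrib_left)
  finally have lhs: "(\<Sum>i<p. (1 - c) ^ i * (- 1) ^ (p - 1 - i) /
        (fact i * fact (p - 1 - i) * pochhammer (b - b' + real i - real q + 1) q) *
        (pochhammer (b + x) i / pochhammer b i)) = \<dots>" .
  have inner: "(\<Sum>r<p - l. (1 - c) ^ (l + r) * (- 1) ^ (p - 1 - (l + r) + l) /
        (fact r * fact (p - 1 - (l + r)) * pochhammer (z + real (l + r)) q)) =
      (- 1) ^ (p - 1) * (\<Sum>m<p - l. (1 - c) ^ (p - 1) * (pochhammer z l / pochhammer z (p + q - 1)) *
         (pochhammer (b' - b - real p + 1) m * pochhammer (real q) (p - 1 - l - m) /
           (fact m * fact (p - 1 - l - m)) * (c / (c - 1)) ^ m))" if "l < p" for l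
  proof -
    define n where "n = p - 1 - l"
    define A where "A = z + real l"
    have pn: "p = Suc (l + n)" using that by (simp add: n_def)
    have "(\<Sum>r<p - l. (1 - c) ^ (l + r) * (- 1) ^ (p - 1 - (l + r) + l) /
        (fact r * fact (p - 1 - (l + r)) * pochhammer (z + real (l + r)) q)) =
        (- 1) ^ (p - 1) * (1 - c) ^ l / fact n *
          (\<Sum>r\<le>n. real (n choose r) * (- (1 - c)) ^ r * (1 / pochhammer (A + real r) q))"
      unfolding sum_distrib_left
    proof (intro sum.cong)
      fix r assume "r \<in> {..n}"
      then have r: "r \<le> n" by simp
      then have "real (n choose r) = fact n / (fact r * fact (n - r))" by (simp add: binomial_fact)
      moreover have "(- 1 :: real) ^ (p - 1 - (l + r) + l) = (- 1) ^ (p - 1) * (- 1) ^ r"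
      proof -
        \<comment> \<open>Adding the even number 2r to the exponent compares parities without
          truncated subtraction.\<close>
        have "p - 1 - (l + r) + l + 2 * r = p - 1 + r" using r pn by simp
        then have "(- 1 :: real) ^ (p - 1 - (l + r) + l) * (- 1) ^ (2 * r) = (- 1) ^ (p - 1) * (- 1) ^ r"
          by (metis power_add)
        then show ?thesis by simp
      qed
      moreover have "p - 1 - (l + r) = n - r" by (simp add: n_def)
      moreover have "(- (1 - c)) ^ r = (- 1) ^ r * (1 - c) ^ r" by (rule power_minus)
      ultimately show "(1 - c) ^ (l + r) * (- 1) ^ (p - 1 - (l + r) + l) /
        (fact r * fact (p - 1 - (l + r)) * pochhammer (z + real (l + r)) q) =
        (- 1) ^ (p - 1) * (1 - c) ^ l / fact n * (real (n choose r) * (- (1 - c)) ^ r * (1 / pochhammer (A + real r) q))"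
        by (simp add: A_def power_add add.assoc)
    qed (use pn in auto)
    also have "\<dots> = (- 1) ^ (p - 1) * (\<Sum>m\<le>n. (1 - c) ^ l / fact n * (real (n choose m) * c ^ m * (1 - c) ^ (n - m) *
            (pochhammer (real q) (n - m) / pochhammer A (q + (n - m)))))"
      using binomial_sum_inverse_pochhammer[of A n "1 - c" q] nint[of l]
      by (simp add: A_def sum_distrib_left mult_ac)
    also have "(\<Sum>m\<le>n. (1 - c) ^ l / fact n * (real (n choose m) * c ^ m * (1 - c) ^ (n - m) *
            (pochhammer (real q) (n - m) / pochhammer A (q + (n - m))))) =
       (\<Sum>m<p - l. (1 - c) ^ (p - 1) * (pochhammer z l / pochhammer z (p + q - 1)) *
         (pochhammer (b' - b - real p + 1) m * pochhammer (real q) (p - 1 - l - m) /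
           (fact m * fact (p - 1 - l - m)) * (c / (c - 1)) ^ m))"
    proof (intro sum.cong)
      fix m assume "m \<in> {..<p - l}"
      then have m: "m \<le> n" by (simp add: pn)
      have b: "real (n choose m) = fact n / (fact m * fact (n - m))" using m by (simp add: binomial_fact)
      \<comment> \<open>The splitting (z)_(p+q-1) = (z)_l \<open>Y\<close> \<open>B\<close> isolates
        the denominator \<open>Y\<close> produced by the transformation. The factor \<open>B\<close>
        equals (b' - b - p + 1)_m up to sign and cancels against it.\<close>
      define B where "B = pochhammer (A + real (q + (n - m))) m"
      define Y where "Y = pochhammer A (q + (n - m))"
      have B: "B \<noteq> 0" using nz[of "l + (q + (n - m))" m] by (simp add: B_def A_def add_ac)
      have Y: "Y \<noteq> 0" using nz by (simp add: Y_def A_def)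
      have "pochhammer z (p + q - 1) = pochhammer z l * pochhammer A (q + n)"
        using pochhammer_product'[of z l "q + n"] by (simp add: A_def pn add_ac)
      moreover have "pochhammer A (q + n) = Y * B"
        using pochhammer_product'[of A "q + (n - m)" m] m by (simp add: B_def Y_def)
      ultimately have p1: "pochhammer z l / pochhammer z (p + q - 1) = 1 / (Y * B)"
        using nz0[of l] by simp
      have e1: "b' - b - real p + 1 = - (b - b' + real p - 1)" by simp
      have e2: "b - b' + real p - 1 - real m + 1 = A + real (q + (n - m))"
        using m by (simp add: A_def z_def pn of_nat_diff)
      have p2: "pochhammer (b' - b - real p + 1) m = (- 1) ^ m * B"
        unfolding e1 pochhammer_minus e2 B_def ..
      have "(c / (c - 1)) ^ m * ((- 1) ^ m * (1 - c) ^ m) = c ^ m"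
        using assms by (simp flip: power_mult_distrib)
      moreover have "(1 - c) ^ (p - 1) = (1 - c) ^ l * (1 - c) ^ (n - m) * (1 - c) ^ m"
        using m by (simp add: pn flip: power_add)
      ultimately have p3: "(1 - c) ^ (p - 1) * ((- 1) ^ m * (c / (c - 1)) ^ m) = (1 - c) ^ l * (1 - c) ^ (n - m) * c ^ m"
        by (simp add: mult_ac)
      have "(1 - c) ^ (p - 1) * (pochhammer z l / pochhammer z (p + q - 1)) *
         (pochhammer (b' - b - real p + 1) m * pochhammer (real q) (p - 1 - l - m) /
           (fact m * fact (p - 1 - l - m)) * (c / (c - 1)) ^ m) =
         ((1 - c) ^ (p - 1) * ((- 1) ^ m * (c / (c - 1)) ^ m)) * (pochhammer (real q) (n - m) /
           (fact m * fact (n - m)) / Y)"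
        unfolding p1 p2 n_def[symmetric] using B by (simp add: mult_ac)
      then show "(1 - c) ^ l / fact n * (real (n choose m) * c ^ m * (1 - c) ^ (n - m) *
            (pochhammer (real q) (n - m) / pochhammer A (q + (n - m)))) =
        (1 - c) ^ (p - 1) * (pochhammer z l / pochhammer z (p + q - 1)) *
         (pochhammer (b' - b - real p + 1) m * pochhammer (real q) (p - 1 - l - m) /
           (fact m * fact (p - 1 - l - m)) * (c / (c - 1)) ^ m)"
        unfolding p3 b Y_def[symmetric] by simp
    qed (use pn in auto)
    finally show ?thesis .
  qed
  have "z \<notin> \<int>\<^sub>\<le>\<^sub>0" using nint[of 0] nonpos_Ints_Int by auto
  then have e1: "pochhammer z (p + q - 1) = Gamma (z + real (p + q - 1)) / Gamma z"
    by (rule pochhammer_Gamma)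
  have e2: "z + real (p + q - 1) = b - b' + real p" using assms by (simp add: z_def of_nat_diff)
  have G: "Gamma z / Gamma (b - b' + real p) = 1 / pochhammer z (p + q - 1)"
    unfolding e1 e2[symmetric] by simp
  \<comment> \<open>The exponent is split so that p + q - 1 and b account for the outer constant
    \<open>C\<close>, and p - 1 for the power inside the transformed sum.\<close>
  have "(1 - c) powr (b + real p + real q + real p - 2) = (1 - c) powr (b + real (p - 1) + real (p + q - 1))"
    using assms by (simp add: of_nat_diff algebra_simps)
  also have "\<dots> = (1 - c) powr b * (1 - c) ^ (p - 1) * (1 - c) ^ (p + q - 1)"
    using assms by (simp only: powr_add powr_realpow diff_gt_0_iff_gt)
  finally have p1: "(1 - c) powr (b + real p + real q + real p - 2) = \<dots>" .
  have "c powr (real p + real q - 1) = c powr (real (p + q - 1))" using assms by (simp add: of_nat_diff)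
  also have "\<dots> = c ^ (p + q - 1)" using assms by (intro powr_realpow) auto
  finally have p2: "c powr (real p + real q - 1) = c ^ (p + q - 1)" .
  have "type_I_regular b b' c p (real q) x = C * (\<Sum>l<p. X l * ((- 1) ^ (p - 1) * (\<Sum>m<p - l. (1 - c) ^ (p - 1) * (pochhammer z l / pochhammer z (p + q - 1)) *
         (pochhammer (b' - b - real p + 1) m * pochhammer (real q) (p - 1 - l - m) /
           (fact m * fact (p - 1 - l - m)) * (c / (c - 1)) ^ m))))"
    unfolding type_I_regular_def p1 p2 z_def[symmetric] G C_def X_def power_divide
    by (simp add: sum_distrib_left mult_ac)
  also have "\<dots> = C * (\<Sum>l<p. X l * (\<Sum>r<p - l. (1 - c) ^ (l + r) * (- 1) ^ (p - 1 - (l + r) + l) /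
        (fact r * fact (p - 1 - (l + r)) * pochhammer (z + real (l + r)) q)))"
    using inner by simp
  finally show ?thesis unfolding C_def lhs .
qed

text \<open>Continuity at q = 0: no quotient of vanishing factors is left, and b - b' not being an
  integer keeps the Gamma arguments away from the poles.\<close>

lemma tendsto_type_I_regular:
  assumes "b > 0" "b - b' \<notin> \<int>" "0 < c" "c < 1"
  shows "((\<lambda>q. type_I_regular b b' c p q x) \<longlongrightarrow> type_I_regular b b' c p 0 x) (at 0)"
proof -
  have i: "b - b' - 0 + 1 \<notin> \<int>\<^sub>\<le>\<^sub>0" "b - b' + real p \<notin> \<int>\<^sub>\<le>\<^sub>0"
  proof -
    have "b - b' + real k \<notin> \<int>" for k
      by (rule not_Ints_add[OF assms(2)]) simp
    from this[of 1] this[of p] show "b - b' - 0 + 1 \<notin> \<int>\<^sub>\<le>\<^sub>0" "b - b' + real p \<notin> \<int>\<^sub>\<le>\<^sub>0"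
      using nonpos_Ints_Int by auto
  qed
  have p: "((\<lambda>q. pochhammer (f q) k) \<longlongrightarrow> pochhammer L k) (at 0)" if "(f \<longlongrightarrow> L) (at 0)" for f and L :: real and k
    by (rule isCont_tendsto_compose[OF isCont_pochhammer that])
  have pb: "pochhammer b l \<noteq> 0" for l using pochhammer_pos[OF assms(1), of l] by simp
  have "Gamma (b - b' + real p) \<noteq> 0" using i by (simp add: Gamma_eq_zero_iff)
  moreover have "1 - c \<noteq> 0" "c \<noteq> 0" "c powr (real p + 0 - 1) \<noteq> 0" using assms by auto
  ultimately show ?thesis
    unfolding type_I_regular_def using i(1)
    by (intro tendsto_const tendsto_ident_at tendsto_mult tendsto_divide tendsto_powr tendsto_add
          tendsto_diff tendsto_Gamma tendsto_sum p) (simp_all add: pb)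
qed

section \<open>From biorthogonality to the stated formulas\<close>

theorem proposition5p1:
  fixes \<beta> :: "nat \<Rightarrow> real" and c :: real and n :: "nat \<Rightarrow> nat"
    and M :: "nat \<Rightarrow> real poly" and a :: nat and x :: real
  assumes "\<beta> 1 > 0" and "\<beta> 2 > 0" and "\<beta> 1 - \<beta> 2 \<notin> \<int>"
    and "0 < c" and "c < 1"
    and "meixner_type_I \<beta> c n M"
    and "a \<in> {1, 2}"
  shows
    "(n a \<ge> 1 \<and> hat n a \<ge> 1 \<longrightarrow>
        poly (M a) x = type_I_const (\<beta> a) (hat \<beta> a) c (n a) (hat n a) *
                       type_I_series (\<beta> a) (hat \<beta> a) c (n a) (real (hat n a)) x \<and>
        poly (M a) x = type_I_const (\<beta> a) (hat \<beta> a) c (n a) (hat n a) *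
                       type_I_sum (\<beta> a) (hat \<beta> a) c (n a) (real (hat n a)) x) \<and>
     (n a \<ge> 1 \<and> hat n a = 0 \<longrightarrow>
        ((\<lambda>q. type_I_const_real (\<beta> a) (hat \<beta> a) c (n a) q *
              type_I_series (\<beta> a) (hat \<beta> a) c (n a) q x) \<longlongrightarrow> poly (M a) x) (at 0) \<and>
        ((\<lambda>q. type_I_const_real (\<beta> a) (hat \<beta> a) c (n a) q *
              type_I_sum (\<beta> a) (hat \<beta> a) c (n a) q x) \<longlongrightarrow> poly (M a) x) (at 0)) \<and>
     (n a = 0 \<longrightarrow> poly (M a) x = 0)"
proof -
  \<comment> \<open>The type I form is symmetric under exchange of the two indices, so these names
    treat a = 1 and a = 2 at once.\<close>
  define b b' p q where "b = \<beta> a" and "b' = hat \<beta> a" and "p = n a" and "q = hat n a"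
  have pos: "b > 0" "b' > 0" using assms(1,2,7) by (auto simp: b_def b'_def hat_def)
  have "\<beta> 2 - \<beta> 1 \<notin> \<int>" using assms(3) Ints_minus[of "\<beta> 2 - \<beta> 1"] by auto
  then have nint: "b - b' \<notin> \<int>" using assms(3,7) by (auto simp: b_def b'_def hat_def)
  have deg: "M a = 0 \<or> degree (M a) < p" "hat M a = 0 \<or> degree (hat M a) < q"
    using assms(6,7) by (auto simp: meixner_type_I_def p_def q_def hat_def)
  have pq: "n 1 + n 2 = p + q" using assms(7) by (auto simp: p_def q_def hat_def)
  define w where "w k = poly (M a) (real k) * meixner_weight b c k + poly (hat M a) (real k) * meixner_weight b' c k" for k
  have w: "type_I_form \<beta> c M k = w k" for k
    using assms(7) by (auto simp: type_I_form_def w_def b_def b'_def hat_def)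
  have low: "(\<lambda>k. pochhammer (- real k) j * w k) sums 0" if "j + 2 \<le> p + q" for j
    using assms(6) that unfolding meixner_type_I_def pq w by blast
  have explicit: "poly (M a) x = type_I_regular b b' c p (real q) x" if p1: "p \<ge> 1"
  proof -
    define N where "N = p + q - 1"
    \<comment> \<open>The index (N, 0) satisfies m 1 + m 2 + 1 = n 1 + n 2 for either value of
      \<open>a\<close>, so the pairing with \<open>P\<close> is 1.\<close>
    obtain P where P: "meixner_type_II \<beta> c (\<lambda>a. if a = 1 then N else 0) P"
      using meixner_type_II_exists[of \<beta>, OF assms(1,4,5)] by blast
    then have PN: "degree P \<le> N" "coeff P N = 1" by (auto simp: meixner_type_II_def)
    have one: "(\<lambda>k. poly P (real k) * w k) sums 1"
    proof -
      have "(\<lambda>k. poly P (real k) * type_I_form \<beta> c M k) sums 1"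
        using assms(6) P p1 unfolding meixner_type_I_def pq N_def by fastforce
      then show ?thesis by (simp add: w)
    qed
    \<comment> \<open>In the basis (-k)_i the terms with i < N pair to 0 by \<open>low\<close>.
      Hence the pairing with the monic \<open>P\<close> fixes the moment against (-k)_N as
      (-1)^N.\<close>
    obtain d where d: "d N = (- 1) ^ N" "\<And>y. poly P y = (\<Sum>i\<le>N. d i * pochhammer (- y) i)"
      using falling_basis[OF PN(1)] PN(2) by auto
    have "(\<lambda>k. \<Sum>i<N. d i * (pochhammer (- real k) i * w k)) sums (\<Sum>i<N. d i * 0)"
      by (intro sums_sum sums_mult low) (auto simp: N_def)
    from sums_mult[OF sums_diff[OF one this], of "(- 1) ^ N"]
    have "(\<lambda>k. (- 1) ^ N * (poly P (real k) * w k - (\<Sum>i<N. d i * (pochhammer (- real k) i * w k)))) sums (- 1) ^ N"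
      by simp
    moreover have "poly P (real k) * w k - (\<Sum>i<N. d i * (pochhammer (- real k) i * w k)) =
        (- 1) ^ N * (pochhammer (- real k) N * w k)" for k
    proof -
      have "poly P (real k) = (\<Sum>i<N. d i * pochhammer (- real k) i) + (- 1) ^ N * pochhammer (- real k) N"
        unfolding d(2) lessThan_Suc_atMost[symmetric] by (simp add: d(1))
      then show ?thesis by (simp add: distrib_right sum_distrib_right mult.assoc)
    qed
    ultimately have "(\<lambda>k. pochhammer (- real k) N * w k) sums (- 1) ^ N"
      by (simp flip: mult.assoc power_mult_distrib)
    then have "poly (M a) x = ((1 - c) / c) ^ (p + q - 1) * (1 - c) powr b *
     (\<Sum>i<p. (1 - c) ^ i * (- 1) ^ (p - 1 - i) /
        (fact i * fact (p - 1 - i) * pochhammer (b - b' + real i - real q + 1) q) *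
        (pochhammer (b + x) i / pochhammer b i))"
      using low unfolding w_def N_def by (intro type_I_explicit[OF pos nint assms(4,5) deg p1])
    also have "\<dots> = type_I_regular b b' c p (real q) x"
      using type_I_regular_of_nat[OF pos(1) nint assms(4,5) p1] by simp
    finally show ?thesis .
  qed
  have gen: "poly (M a) x = type_I_const b b' c p q * type_I_sum b b' c p (real q) x"
    if "p \<ge> 1" "q \<ge> 1"
  proof -
    have "real q \<notin> \<int>\<^sub>\<le>\<^sub>0" using that by (auto elim!: nonpos_Ints_cases')
    then show ?thesis
      using explicit that type_I_const_real_of_nat[OF assms(4) that nint] type_I_const_real_times_sum
      by metis
  qed
  have lim: "((\<lambda>q. type_I_const_real b b' c p q * type_I_sum b b' c p q x) \<longlongrightarrow> poly (M a) x) (at 0)"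
    if "p \<ge> 1" "q = 0"
  proof -
    \<comment> \<open>In this punctured neighbourhood \<open>q\<close> is no nonpositive integer, so
      constant times sum equals the regular form, whose value at 0 is already known to be
      \<open>poly (M a) x\<close>.\<close>
    have "eventually (\<lambda>q :: real. \<bar>q\<bar> < 1 \<and> q \<noteq> 0) (at 0)"
      unfolding eventually_at by (intro exI[of _ 1]) auto
    then have "eventually (\<lambda>q. type_I_regular b b' c p q x = type_I_const_real b b' c p q * type_I_sum b b' c p q x) (at 0)"
    proof eventually_elim
      case (elim q)
      have "q \<notin> \<int>\<^sub>\<le>\<^sub>0"
      proof
        assume "q \<in> \<int>\<^sub>\<le>\<^sub>0"
        then obtain k where "q = - real k" by (auto elim!: nonpos_Ints_cases')
        then show False using elim by (cases k) auto
      qed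
      then show ?case using type_I_const_real_times_sum[OF that(1)] by simp
    qed
    moreover have "poly (M a) x = type_I_regular b b' c p 0 x" using explicit that by simp
    ultimately show ?thesis
      using Lim_transform_eventually[OF tendsto_type_I_regular[OF pos(1) nint assms(4,5), of p x]] by simp
  qed
  have "poly (M a) x = 0" if "p = 0" using deg that by simp
  then show ?thesis
    unfolding b_def[symmetric] b'_def[symmetric] p_def[symmetric] q_def[symmetric]
    using gen lim type_I_series_eq_sum by simp
qed

end
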